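(* Let $n\ge 1$ be an integer, let $p\in(0,1)$, and let $P$ be the Bernoulli product measure of parameter $p$ on $\Omega=\{0,1\}^n$. Let $A,B\subset\Omega$ be two increasing events. Then the equality $$P(A\circ B)=P(A)P(B)$$ holds if and only if for every $(u,v)\in A\times B$ there exist disjoint witnesses for $A,B$ in $(u,v)$.
   Context: The Bernoulli product measure $P$ of parameter $p$ on $\Omega=\{0,1\}^n$ is the one for which the $n$ coordinates are independent, each equal to $1$ with probability $p$ and to $0$ with probability $1-p$. The set $\Omega$ carries the product order: $x\le y$ if $x_i\le y_i$ for all $1\le i\le n$. A subset $A$ of $\Omega$ is increasing if $x\mapsto 1_A(x)$ is non-decreasing for this order. Witness: for $A\subset\Omega$ and $x\in A$, a subset $I$ of $\{1,\dots,n\}$ is a witness for $A$ in $x$ if every $y\in\Omega$ satisfying $y_i=x_i$ for all $i\in I$ belongs to $A$. Disjoint witnesses: for $A,B\subset\Omega$ and $(u,v)\in A\times B$, there exist disjoint witnesses for $A,B$ in $(u,v)$ if there exist two disjoint subsets $I,J$ of $\{1,\dots,n\}$ such that $I$ is a witness for $A$ in $u$ and $J$ is a witness for $B$ in $v$. Disjoint occurrence: $A\circ B$ is the set of the configurations $u\in A\cap B$ such that there exist disjoint witnesses for $A,B$ in $(u,u)$. *)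

theory Defs
  imports "HOL-Probability.Probability"
begin

text \<open>
  Configurations are extensional functions on \<open>{1..n}\<close> (equal to \<open>undefined\<close> elsewhere),
  with \<open>False\<close> and \<open>True\<close> standing for 0 and 1; note that \<open>False \<le> True\<close>.
\<close>

definition config_space :: "nat \<Rightarrow> (nat \<Rightarrow> bool) set" where
  "config_space n = (\<Pi>\<^sub>E i\<in>{1..n}. UNIV)"

text \<open>
  The default value \<open>undefined\<close> in the library product makes the measure live on the
  extensional functions of \<^term>\<open>config_space n\<close>.
\<close>

definition bernoulli_product :: "nat \<Rightarrow> real \<Rightarrow> (nat \<Rightarrow> bool) pmf" where
  "bernoulli_product n p = Pi_pmf {1..n} undefined (\<lambda>_. bernoulli_pmf p)"

definition config_le :: "nat \<Rightarrow> (nat \<Rightarrow> bool) \<Rightarrow> (nat \<Rightarrow> bool) \<Rightarrow> bool" where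
  "config_le n x y \<longleftrightarrow> (\<forall>i\<in>{1..n}. x i \<le> y i)"

definition increasing_event :: "nat \<Rightarrow> (nat \<Rightarrow> bool) set \<Rightarrow> bool" where
  "increasing_event n A \<longleftrightarrow>
     A \<subseteq> config_space n \<and>
     monotone_on (config_space n) (config_le n) (\<le>) (indicator A :: (nat \<Rightarrow> bool) \<Rightarrow> real)"

definition witness :: "nat \<Rightarrow> (nat \<Rightarrow> bool) set \<Rightarrow> (nat \<Rightarrow> bool) \<Rightarrow> nat set \<Rightarrow> bool" where
  "witness n A x I \<longleftrightarrow>
     I \<subseteq> {1..n} \<and> (\<forall>y\<in>config_space n. (\<forall>i\<in>I. y i = x i) \<longrightarrow> y \<in> A)"

definition disjoint_witnesses ::
  "nat \<Rightarrow> (nat \<Rightarrow> bool) set \<Rightarrow> (nat \<Rightarrow> bool) set \<Rightarrow> (nat \<Rightarrow> bool) \<Rightarrow> (nat \<Rightarrow> bool) \<Rightarrow> bool" where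
  "disjoint_witnesses n A B u v \<longleftrightarrow>
     (\<exists>I J. I \<inter> J = {} \<and> witness n A u I \<and> witness n B v J)"

definition disjoint_occurrence ::
  "nat \<Rightarrow> (nat \<Rightarrow> bool) set \<Rightarrow> (nat \<Rightarrow> bool) set \<Rightarrow> (nat \<Rightarrow> bool) set" where
  "disjoint_occurrence n A B = {u \<in> A \<inter> B. disjoint_witnesses n A B u u}"

end

theory Submission
  imports Defs
begin

text \<open>
  A configuration is identified with the set of its coordinates equal to 1.  By monotonicity, a
  witness for an increasing event may be shrunk to the coordinates equal to 1, so that disjoint
  witnesses in \<open>(u, v)\<close> amount to disjoint sets \<open>a \<subseteq> u\<close>, \<open>b \<subseteq> v\<close> with \<open>a\<close> in the first event and
  \<open>b\<close> in the second.

  An induction on the number of coordinates does not close up for pairs of events, but it does for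
  one increasing family \<open>W\<close> of \<^emph>\<open>pairs\<close> of sets.  Let \<open>D(W)\<close> be the family of the sets containing
  \<open>a \<union> b\<close> for some \<open>(a, b) \<in> W\<close> with \<open>a \<inter> b = {}\<close>; for \<open>W = A \<times> B\<close> this is the disjoint occurrence
  of \<open>A\<close> and \<open>B\<close>.  Let \<open>gap(W)\<close> be the probability of \<open>W\<close> under the product of two copies of the
  measure minus the probability of \<open>D(W)\<close>.  For a new coordinate \<open>k\<close>, let \<open>W\<^sub>1\<^sub>0\<close>, \<open>W\<^sub>0\<^sub>1\<close> and \<open>W\<^sub>1\<^sub>1\<close>
  be the sections of \<open>W\<close> obtained by adding \<open>k\<close> to the first set, to the second set and to both.
  As \<open>D\<close> commutes with unions, the section of \<open>D(W)\<close> at \<open>k\<close> present is \<open>D(W\<^sub>1\<^sub>0 \<union> W\<^sub>0\<^sub>1)\<close>, while the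
  section at \<open>k\<close> absent is \<open>D(W)\<close>.  Inclusion-exclusion for \<open>W\<^sub>1\<^sub>0\<close> and \<open>W\<^sub>0\<^sub>1\<close> then gives, with all
  probabilities on the right taken without the coordinate \<open>k\<close>,
  \<open>gap(W) = p gap(W\<^sub>1\<^sub>0 \<union> W\<^sub>0\<^sub>1) + (1-p) gap(W) + p(1-p) P(W\<^sub>1\<^sub>0 \<inter> W\<^sub>0\<^sub>1 - W) + p\<^sup>2 P(W\<^sub>1\<^sub>1 - (W\<^sub>1\<^sub>0 \<union> W\<^sub>0\<^sub>1))\<close>
  (lemma \<open>bk_gap_insert\<close>).

  Hence the gap is nonnegative, which is the van den Berg-Kesten inequality, and it vanishes
  exactly when all four terms vanish.  An induction shows that a vanishing gap forces every pair in
  \<open>W\<close> to dominate a disjoint pair in \<open>W\<close> (\<open>split_if_bk_gap_zero\<close>).  A second induction gives the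
  converse for rectangles \<open>W = A \<times> B\<close> (\<open>bk_gap_zero_if_split\<close>).
\<close>

section \<open>Random subsets\<close>

definition random_subset :: "real \<Rightarrow> 'a set \<Rightarrow> 'a set pmf" where
  "random_subset p S = map_pmf (\<lambda>x. {i \<in> S. x i}) (Pi_pmf S undefined (\<lambda>_. bernoulli_pmf p))"

lemma random_subset_insert:
  assumes "finite S" "k \<notin> S"
  shows "random_subset p (insert k S) =
    bernoulli_pmf p \<bind> (\<lambda>b. map_pmf (if b then insert k else id) (random_subset p S))"
proof -
  have *: "{i \<in> insert k S. (x(k := b)) i} = (if b then insert k else id) {i \<in> S. x i}"
    for x :: "'a \<Rightarrow> bool" and b using assms(2) by auto
  show ?thesis
    unfolding random_subset_def Pi_pmf_insert[OF assms] pair_pmf_def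
    by (simp only: map_bind_pmf map_pmf_comp map_return_pmf case_prod_conv *)
      (simp only: map_pmf_def bind_assoc_pmf bind_return_pmf)
qed

lemma set_pmf_random_subset:
  assumes "finite S" "0 < p" "p < 1"
  shows "set_pmf (random_subset p S) = Pow S"
  using assms(1)
proof (induction S rule: finite_induct)
  case empty
  then show ?case by (simp add: random_subset_def)
next
  case (insert k S)
  then show ?case using assms(2,3)
    by (auto simp: random_subset_insert Pow_insert UNIV_bool)
qed

lemma prob_bind_bernoulli:
  assumes "0 \<le> p" "p \<le> 1"
  shows "measure_pmf.prob (bernoulli_pmf p \<bind> f) E =
    p * measure_pmf.prob (f True) E + (1 - p) * measure_pmf.prob (f False) E"
proof -
  have "emeasure (measure_pmf (bernoulli_pmf p \<bind> f)) E =
      ennreal (p * measure_pmf.prob (f True) E + (1 - p) * measure_pmf.prob (f False) E)"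
    using assms unfolding emeasure_bind_pmf
    by (simp add: measure_pmf.emeasure_eq_measure ennreal_mult ennreal_plus mult.commute)
  then show ?thesis
    unfolding measure_pmf.emeasure_eq_measure using assms by (subst (asm) ennreal_inj) auto
qed

lemma prob_random_subset_insert:
  assumes "finite S" "k \<notin> S" "0 \<le> p" "p \<le> 1"
  shows "measure_pmf.prob (random_subset p (insert k S)) E =
    p * measure_pmf.prob (random_subset p S) {a. insert k a \<in> E} +
    (1 - p) * measure_pmf.prob (random_subset p S) E"
  using assms by (simp add: random_subset_insert prob_bind_bernoulli vimage_def)

abbreviation random_pair :: "real \<Rightarrow> 'a set \<Rightarrow> ('a set \<times> 'a set) pmf" where
  "random_pair p S \<equiv> pair_pmf (random_subset p S) (random_subset p S)"

definition sect10 :: "'a \<Rightarrow> ('a set \<times> 'a set) set \<Rightarrow> ('a set \<times> 'a set) set" where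
  "sect10 k W = {(a, b). (insert k a, b) \<in> W}"

definition sect01 :: "'a \<Rightarrow> ('a set \<times> 'a set) set \<Rightarrow> ('a set \<times> 'a set) set" where
  "sect01 k W = {(a, b). (a, insert k b) \<in> W}"

definition sect11 :: "'a \<Rightarrow> ('a set \<times> 'a set) set \<Rightarrow> ('a set \<times> 'a set) set" where
  "sect11 k W = {(a, b). (insert k a, insert k b) \<in> W}"

lemma prob_random_pair_insert:
  assumes "finite S" "k \<notin> S" "0 \<le> p" "p \<le> 1"
  shows "measure_pmf.prob (random_pair p (insert k S)) W =
      p * p * measure_pmf.prob (random_pair p S) (sect11 k W) +
      p * (1 - p) * (measure_pmf.prob (random_pair p S) (sect10 k W) +
                     measure_pmf.prob (random_pair p S) (sect01 k W)) +
      (1 - p) * (1 - p) * measure_pmf.prob (random_pair p S) W"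
proof -
  have "random_pair p (insert k S) = bernoulli_pmf p \<bind> (\<lambda>b. bernoulli_pmf p \<bind> (\<lambda>c.
      map_pmf (\<lambda>(x, y). ((if b then insert k else id) x, (if c then insert k else id) y))
        (random_pair p S)))"
    unfolding map_pair unfolding random_subset_insert[OF assms(1,2)] pair_pmf_def
    by (simp only: bind_assoc_pmf)
      (subst bind_commute_pmf[of "map_pmf _ _" "bernoulli_pmf p"], simp only:)
  then show ?thesis using assms(3,4)
    by (simp add: prob_bind_bernoulli vimage_def sect10_def sect01_def sect11_def
        case_prod_beta' algebra_simps)
qed

section \<open>Disjoint occurrence for families of pairs\<close>

definition up_pairs :: "('a set \<times> 'a set) set \<Rightarrow> bool" where
  "up_pairs W \<longleftrightarrow> (\<forall>a b a' b'. (a, b) \<in> W \<longrightarrow> a \<subseteq> a' \<longrightarrow> b \<subseteq> b' \<longrightarrow> (a', b') \<in> W)"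

definition disjoint_occ :: "('a set \<times> 'a set) set \<Rightarrow> 'a set set" where
  "disjoint_occ W = {u. \<exists>(a, b) \<in> W. a \<inter> b = {} \<and> a \<union> b \<subseteq> u}"

definition bk_gap :: "real \<Rightarrow> 'a set \<Rightarrow> ('a set \<times> 'a set) set \<Rightarrow> real" where
  "bk_gap p S W = measure_pmf.prob (random_pair p S) W
                - measure_pmf.prob (random_subset p S) (disjoint_occ W)"

definition split_on :: "'a set \<Rightarrow> ('a set \<times> 'a set) set \<Rightarrow> bool" where
  "split_on S W \<longleftrightarrow> (\<forall>u v. (u, v) \<in> W \<longrightarrow> u \<subseteq> S \<longrightarrow> v \<subseteq> S \<longrightarrow>
     (\<exists>(a, b) \<in> W. a \<inter> b = {} \<and> a \<subseteq> u \<and> b \<subseteq> v))"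

lemma up_pairsD: "up_pairs W \<Longrightarrow> (a, b) \<in> W \<Longrightarrow> a \<subseteq> a' \<Longrightarrow> b \<subseteq> b' \<Longrightarrow> (a', b') \<in> W"
  unfolding up_pairs_def by blast

lemma split_onD:
  assumes "split_on S W" "(u, v) \<in> W" "u \<subseteq> S" "v \<subseteq> S"
  obtains a b where "(a, b) \<in> W" "a \<inter> b = {}" "a \<subseteq> u" "b \<subseteq> v"
  using assms unfolding split_on_def by blast

lemma up_pairs_sections:
  assumes "up_pairs W"
  shows "up_pairs (sect10 k W \<union> sect01 k W)"
  unfolding up_pairs_def sect10_def sect01_def
  by (auto intro: up_pairsD[OF assms] dest: insert_mono)

lemma sections_subset:
  assumes "up_pairs W"
  shows "W \<subseteq> sect10 k W \<inter> sect01 k W" "sect10 k W \<union> sect01 k W \<subseteq> sect11 k W"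
  unfolding sect10_def sect01_def sect11_def by (auto intro: up_pairsD[OF assms])

text \<open>
  In a disjoint pair at most one of the two sets contains \<open>k\<close>; this is why the union of the two
  mixed sections governs the case where \<open>k\<close> is present.
\<close>
lemma remove_from_disjoint_pair:
  assumes "up_pairs W" "(a, b) \<in> W" "a \<inter> b = {}"
  shows "(a - {k}, b - {k}) \<in> sect10 k W \<union> sect01 k W"
proof (cases "k \<in> b")
  case True
  with assms(3) show ?thesis
    by (auto simp: sect01_def intro!: up_pairsD[OF assms(1,2)])
next
  case False
  then show ?thesis
    by (auto simp: sect10_def intro!: up_pairsD[OF assms(1,2)])
qed

lemma disjoint_occ_insert_iff:
  assumes "up_pairs W" "k \<notin> u"
  shows "insert k u \<in> disjoint_occ W \<longleftrightarrow> u \<in> disjoint_occ (sect10 k W \<union> sect01 k W)"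
proof
  assume "insert k u \<in> disjoint_occ W"
  then obtain a b where ab: "(a, b) \<in> W" "a \<inter> b = {}" "a \<union> b \<subseteq> insert k u"
    unfolding disjoint_occ_def by blast
  have "(a - {k}, b - {k}) \<in> sect10 k W \<union> sect01 k W"
    by (rule remove_from_disjoint_pair[OF assms(1) ab(1,2)])
  then show "u \<in> disjoint_occ (sect10 k W \<union> sect01 k W)"
    using ab(2,3) unfolding disjoint_occ_def
    by (intro CollectI bexI[of _ "(a - {k}, b - {k})"]) auto
next
  assume "u \<in> disjoint_occ (sect10 k W \<union> sect01 k W)"
  then obtain a b where "(insert k a, b) \<in> W \<or> (a, insert k b) \<in> W" "a \<inter> b = {}" "a \<union> b \<subseteq> u"
    unfolding disjoint_occ_def sect10_def sect01_def by auto
  moreover from this have "insert k a \<inter> b = {}" "a \<inter> insert k b = {}"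
    using assms(2) by auto
  ultimately show "insert k u \<in> disjoint_occ W"
    unfolding disjoint_occ_def by blast
qed

section \<open>The gap in the van den Berg-Kesten inequality\<close>

text \<open>
  Of the mass \<open>p P(W\<^sub>1\<^sub>0 \<union> W\<^sub>0\<^sub>1)\<close> in the first term, the part \<open>p\<^sup>2\<close> is compared with \<open>W\<^sub>1\<^sub>1\<close>, and the
  part \<open>p(1-p)\<close> with \<open>P(W\<^sub>1\<^sub>0) + P(W\<^sub>0\<^sub>1)\<close> by inclusion-exclusion; this leaves \<open>W\<^sub>1\<^sub>0 \<inter> W\<^sub>0\<^sub>1\<close> to be
  compared with \<open>W\<close>.
\<close>
lemma bk_gap_insert:
  assumes "finite S" "k \<notin> S" "0 < p" "p < 1" "up_pairs W"
  shows "bk_gap p (insert k S) W =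
      p * bk_gap p S (sect10 k W \<union> sect01 k W) + (1 - p) * bk_gap p S W +
      p * (1 - p) * measure_pmf.prob (random_pair p S) (sect10 k W \<inter> sect01 k W - W) +
      p * p * measure_pmf.prob (random_pair p S) (sect11 k W - (sect10 k W \<union> sect01 k W))"
proof -
  let ?P = "measure_pmf.prob (random_pair p S)"
  let ?U = "sect10 k W \<union> sect01 k W" and ?I = "sect10 k W \<inter> sect01 k W"
  have occ: "measure_pmf.prob (random_subset p S) {a. insert k a \<in> disjoint_occ W} =
      measure_pmf.prob (random_subset p S) (disjoint_occ ?U)"
  proof (rule measure_prob_cong_0)
    fix a assume "a \<in> {a. insert k a \<in> disjoint_occ W} - disjoint_occ ?U"
    then have "k \<in> a" using disjoint_occ_insert_iff[OF assms(5)] by blast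
    then show "pmf (random_subset p S) a = 0"
      using assms(2) set_pmf_random_subset[OF assms(1,3,4)] by (auto simp: pmf_eq_0_set_pmf)
  next
    fix a assume "a \<in> disjoint_occ ?U - {a. insert k a \<in> disjoint_occ W}"
    then have "k \<in> a" using disjoint_occ_insert_iff[OF assms(5)] by blast
    then show "pmf (random_subset p S) a = 0"
      using assms(2) set_pmf_random_subset[OF assms(1,3,4)] by (auto simp: pmf_eq_0_set_pmf)
  qed
  have un: "?P ?U = ?P (sect10 k W) + ?P (sect01 k W) - ?P ?I"
    by (simp add: measure_pmf.finite_measure_Union' measure_pmf.finite_measure_Diff' Int_commute)
  have i: "?P (?I - W) = ?P ?I - ?P W"
    by (rule measure_pmf.finite_measure_Diff) (use sections_subset(1)[OF assms(5)] in auto)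
  have u: "?P (sect11 k W - ?U) = ?P (sect11 k W) - ?P ?U"
    by (rule measure_pmf.finite_measure_Diff) (use sections_subset(2)[OF assms(5)] in auto)
  have prob_pair: "?P (sect10 k W) + ?P (sect01 k W) = ?P ?U + ?P ?I"
    using un by simp
  show ?thesis
    unfolding bk_gap_def i u
    using assms(3,4)
    by (simp add: prob_random_subset_insert[OF assms(1,2)] prob_random_pair_insert[OF assms(1,2)]
        occ prob_pair) (simp add: algebra_simps)
qed

text \<open>The van den Berg-Kesten inequality, for increasing families of pairs.\<close>
lemma bk_gap_nonneg:
  assumes "finite S" "0 < p" "p < 1" "up_pairs W"
  shows "0 \<le> bk_gap p S W"
  using assms(1,4)
proof (induction S arbitrary: W rule: finite_induct)
  case empty
  have "random_subset p {} = return_pmf ({} :: 'a set)" by (simp add: random_subset_def)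
  then show ?case by (auto simp: bk_gap_def disjoint_occ_def indicator_def pair_return_pmf1)
next
  case (insert k S)
  then show ?case
    using assms(2,3) up_pairs_sections[OF insert.prems, of k]
    by (simp add: bk_gap_insert)
qed

lemma bk_gap_insert_zero_iff:
  assumes "finite S" "k \<notin> S" "0 < p" "p < 1" "up_pairs W"
  shows "bk_gap p (insert k S) W = 0 \<longleftrightarrow>
      bk_gap p S (sect10 k W \<union> sect01 k W) = 0 \<and> bk_gap p S W = 0 \<and>
      (Pow S \<times> Pow S) \<inter> (sect10 k W \<inter> sect01 k W) \<subseteq> W \<and>
      (Pow S \<times> Pow S) \<inter> sect11 k W \<subseteq> sect10 k W \<union> sect01 k W"
proof -
  have zero: "measure_pmf.prob (random_pair p S) (X - Y) = 0 \<longleftrightarrow> (Pow S \<times> Pow S) \<inter> X \<subseteq> Y"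
    for X Y unfolding measure_pmf_zero_iff
    using set_pmf_random_subset[OF assms(1,3,4)] by (simp only: set_pair_pmf) blast
  have four: "p * x + (1 - p) * y + p * (1 - p) * z + p * p * w = 0 \<longleftrightarrow>
      x = 0 \<and> y = 0 \<and> z = 0 \<and> w = 0" if "0 \<le> x" "0 \<le> y" "0 \<le> z" "0 \<le> w" for x y z w
    using that assms(3,4) by (simp add: add_nonneg_eq_0_iff)
  show ?thesis
    unfolding bk_gap_insert[OF assms]
    by (subst four) (simp_all only: zero measure_nonneg assms bk_gap_nonneg up_pairs_sections)
qed

section \<open>Families with zero gap\<close>

text \<open>
  Let \<open>(u, v) \<in> W\<close>, and remove \<open>k\<close> from both sets.  The result lies in \<open>W\<^sub>1\<^sub>1\<close>, hence in
  \<open>W\<^sub>1\<^sub>0 \<union> W\<^sub>0\<^sub>1\<close> by the vanishing of the fourth term of the gap, and the induction hypothesis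
  provides a disjoint pair below it in this union.  The danger is that this pair is in the wrong
  section, say in \<open>W\<^sub>0\<^sub>1\<close> although \<open>k \<notin> v\<close>.  Then monotonicity puts the reduced pair in
  \<open>W\<^sub>1\<^sub>0 \<inter> W\<^sub>0\<^sub>1\<close>, hence in \<open>W\<close> by the vanishing of the third term, and the induction hypothesis
  for \<open>W\<close> applies instead.
\<close>
lemma split_if_bk_gap_zero:
  assumes "finite S" "0 < p" "p < 1" "up_pairs W" "bk_gap p S W = 0"
  shows "split_on S W"
  using assms(1,4,5)
proof (induction S arbitrary: W rule: finite_induct)
  case empty
  then show ?case unfolding split_on_def by blast
next
  case (insert k S)
  note up = insert.prems(1)
  let ?U = "sect10 k W \<union> sect01 k W"
  from insert.prems(2)
  have gaps: "bk_gap p S ?U = 0" "bk_gap p S W = 0"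
    and I: "(Pow S \<times> Pow S) \<inter> (sect10 k W \<inter> sect01 k W) \<subseteq> W"
    and J: "(Pow S \<times> Pow S) \<inter> sect11 k W \<subseteq> ?U"
    using bk_gap_insert_zero_iff[OF insert.hyps assms(2,3) up] by blast+
  have splitW: "split_on S W" by (rule insert.IH[OF up gaps(2)])
  have splitU: "split_on S ?U" by (rule insert.IH[OF up_pairs_sections[OF up] gaps(1)])
  show ?case
    unfolding split_on_def
  proof (intro allI impI)
    fix u v assume uv: "(u, v) \<in> W" "u \<subseteq> insert k S" "v \<subseteq> insert k S"
    define u' v' where "u' = u - {k}" and "v' = v - {k}"
    have sub: "u' \<subseteq> S" "v' \<subseteq> S" using uv by (auto simp: u'_def v'_def)
    show "\<exists>(a, b) \<in> W. a \<inter> b = {} \<and> a \<subseteq> u \<and> b \<subseteq> v"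
    proof (cases "(u', v') \<in> W")
      case True
      obtain a b where "(a, b) \<in> W" "a \<inter> b = {}" "a \<subseteq> u'" "b \<subseteq> v'"
        by (rule split_onD[OF splitW True sub])
      then show ?thesis by (intro bexI[of _ "(a, b)"]) (auto simp: u'_def v'_def)
    next
      case False
      have "(u', v') \<in> sect11 k W"
        by (auto simp: sect11_def u'_def v'_def intro!: up_pairsD[OF up uv(1)])
      then have "(u', v') \<in> ?U" using J sub by blast
      then obtain a b where ab: "(a, b) \<in> ?U" "a \<inter> b = {}" "a \<subseteq> u'" "b \<subseteq> v'"
        using split_onD[OF splitU _ sub] by blast
      from ab(1) show ?thesis
      proof
        assume "(a, b) \<in> sect10 k W"
        then have W: "(insert k a, b) \<in> W" by (simp add: sect10_def)
        have "k \<in> u"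
        proof (rule ccontr)
          assume "k \<notin> u"
          then have "(u', insert k v') \<in> W"
            by (auto simp: u'_def v'_def intro!: up_pairsD[OF up uv(1)])
          moreover have "(insert k u', v') \<in> W"
            using ab by (auto intro!: up_pairsD[OF up W])
          ultimately show False
            using I sub False by (auto simp: sect10_def sect01_def)
        qed
        with W ab show ?thesis
          by (intro bexI[of _ "(insert k a, b)"]) (auto simp: u'_def v'_def)
      next
        assume "(a, b) \<in> sect01 k W"
        then have W: "(a, insert k b) \<in> W" by (simp add: sect01_def)
        have "k \<in> v"
        proof (rule ccontr)
          assume "k \<notin> v"
          then have "(insert k u', v') \<in> W"
            by (auto simp: u'_def v'_def intro!: up_pairsD[OF up uv(1)])
          moreover have "(u', insert k v') \<in> W"
            using ab by (auto intro!: up_pairsD[OF up W])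
          ultimately show False
            using I sub False by (auto simp: sect10_def sect01_def)
        qed
        with W ab show ?thesis
          by (intro bexI[of _ "(a, insert k b)"]) (auto simp: u'_def v'_def)
      qed
    qed
  qed
qed

text \<open>
  Rectangularity is imposed only on the subsets of \<open>S\<close>, because \<open>W\<^sub>1\<^sub>0 \<union> W\<^sub>0\<^sub>1\<close> is a rectangle only
  there, where it agrees with \<open>W\<^sub>1\<^sub>1\<close>.
\<close>
definition rectangle_on :: "'a set \<Rightarrow> ('a set \<times> 'a set) set \<Rightarrow> bool" where
  "rectangle_on S W \<longleftrightarrow> (\<forall>a \<subseteq> S. \<forall>b \<subseteq> S. \<forall>c \<subseteq> S. \<forall>d \<subseteq> S.
     (a, b) \<in> W \<longrightarrow> (c, d) \<in> W \<longrightarrow> (a, d) \<in> W)"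

lemma rectangle_onD:
  "rectangle_on S W \<Longrightarrow> (a, b) \<in> W \<Longrightarrow> (c, d) \<in> W \<Longrightarrow> a \<subseteq> S \<Longrightarrow> b \<subseteq> S \<Longrightarrow> c \<subseteq> S \<Longrightarrow> d \<subseteq> S
    \<Longrightarrow> (a, d) \<in> W"
  unfolding rectangle_on_def by blast

lemma rectangle_on_Times: "rectangle_on S (A \<times> B)"
  unfolding rectangle_on_def by blast

text \<open>
  The splitting property is inherited by \<open>W\<close> and by \<open>W\<^sub>1\<^sub>0 \<union> W\<^sub>0\<^sub>1\<close>, and makes the latter agree with
  \<open>W\<^sub>1\<^sub>1\<close>, since a disjoint pair has \<open>k\<close> on at most one side.  Rectangularity is what gives
  \<open>W\<^sub>1\<^sub>0 \<inter> W\<^sub>0\<^sub>1 = W\<close>.  It cannot be dropped: for \<open>S = {k}\<close>, the increasing family generated by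
  \<open>({k}, {})\<close> and \<open>({}, {k})\<close> has the splitting property and a positive gap.
\<close>
lemma bk_gap_zero_if_split:
  assumes "finite S" "0 < p" "p < 1" "up_pairs W" "rectangle_on S W" "split_on S W"
  shows "bk_gap p S W = 0"
  using assms(1,4-6)
proof (induction S arbitrary: W rule: finite_induct)
  case empty
  have "random_subset p {} = return_pmf ({} :: 'a set)" by (simp add: random_subset_def)
  moreover have "({}, {}) \<in> W \<longleftrightarrow> (\<exists>(a, b) \<in> W. a \<inter> b = {} \<and> a \<union> b \<subseteq> {})"
    by auto
  ultimately show ?case
    by (simp add: bk_gap_def disjoint_occ_def indicator_def pair_return_pmf1)
next
  case (insert k S)
  note up = insert.prems(1) and rect = insert.prems(2) and split = insert.prems(3)
  let ?U = "sect10 k W \<union> sect01 k W"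
  have subs: "insert k x \<subseteq> insert k S" "x \<subseteq> insert k S" if "x \<subseteq> S" for x
    using that by auto
  have shrink: "\<exists>(a, b) \<in> ?U. a \<inter> b = {} \<and> a \<subseteq> u \<and> b \<subseteq> v"
    if uv: "(u, v) \<in> sect11 k W" "u \<subseteq> S" "v \<subseteq> S" for u v
  proof -
    have "(insert k u, insert k v) \<in> W" using uv(1) by (simp add: sect11_def)
    then obtain a b where ab: "(a, b) \<in> W" "a \<inter> b = {}" "a \<subseteq> insert k u" "b \<subseteq> insert k v"
      using split_onD[OF split _ subs(1)[OF uv(2)] subs(1)[OF uv(3)]] by blast
    have "(a - {k}, b - {k}) \<in> ?U"
      by (rule remove_from_disjoint_pair[OF up ab(1,2)])
    with ab show ?thesis by (intro bexI[of _ "(a - {k}, b - {k})"]) auto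
  qed
  have J: "(Pow S \<times> Pow S) \<inter> sect11 k W \<subseteq> ?U"
  proof (intro subsetI)
    fix x assume "x \<in> (Pow S \<times> Pow S) \<inter> sect11 k W"
    then obtain u v where x: "x = (u, v)" and uv: "(u, v) \<in> sect11 k W" "u \<subseteq> S" "v \<subseteq> S"
      by (cases x) auto
    obtain a b where "(a, b) \<in> ?U" "a \<subseteq> u" "b \<subseteq> v" using shrink[OF uv] by blast
    then show "x \<in> ?U" unfolding x by (rule up_pairsD[OF up_pairs_sections[OF up]])
  qed
  have "split_on S ?U"
    unfolding split_on_def
  proof (intro allI impI)
    fix u v assume "(u, v) \<in> ?U" and sub: "u \<subseteq> S" "v \<subseteq> S"
    then have "(u, v) \<in> sect11 k W" using subsetD[OF sections_subset(2)[OF up]] by blast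
    then show "\<exists>(a, b) \<in> ?U. a \<inter> b = {} \<and> a \<subseteq> u \<and> b \<subseteq> v"
      using sub by (rule shrink)
  qed
  moreover have "rectangle_on S ?U"
    unfolding rectangle_on_def
  proof (intro allI impI)
    fix a b c d
    assume sub: "a \<subseteq> S" "b \<subseteq> S" "c \<subseteq> S" "d \<subseteq> S" and U: "(a, b) \<in> ?U" "(c, d) \<in> ?U"
    have "(insert k a, insert k b) \<in> W" "(insert k c, insert k d) \<in> W"
      using U sections_subset(2)[OF up, of k] by (auto simp: sect11_def)
    from rectangle_onD[OF rect this] have "(a, d) \<in> sect11 k W"
      using sub by (simp add: sect11_def subs)
    then show "(a, d) \<in> ?U" using J sub by blast
  qed
  moreover have "split_on S W"
    using split unfolding split_on_def by (meson subset_insertI2)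
  moreover have "rectangle_on S W"
    using rect unfolding rectangle_on_def by (meson subset_insertI2)
  moreover have "(Pow S \<times> Pow S) \<inter> (sect10 k W \<inter> sect01 k W) \<subseteq> W"
  proof (intro subsetI)
    fix x assume "x \<in> (Pow S \<times> Pow S) \<inter> (sect10 k W \<inter> sect01 k W)"
    then obtain a b where x: "x = (a, b)" and sub: "a \<subseteq> S" "b \<subseteq> S"
      and W: "(a, insert k b) \<in> W" "(insert k a, b) \<in> W"
      by (cases x) (auto simp: sect10_def sect01_def)
    show "x \<in> W" unfolding x by (rule rectangle_onD[OF rect W]) (use sub in auto)
  qed
  ultimately show ?case
    using J by (simp add: bk_gap_insert_zero_iff insert.hyps assms(2,3) up insert.IH
        up_pairs_sections)
qed

section \<open>Configurations as sets\<close>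

definition ones :: "nat \<Rightarrow> (nat \<Rightarrow> bool) \<Rightarrow> nat set" where
  "ones n x = {i \<in> {1..n}. x i}"

text \<open>
  The sections used in the induction range over all pairs of sets, so an event is translated to a
  family of arbitrary sets; on subsets of \<open>{1..n}\<close> it is the image of the event under
  \<^const>\<open>ones\<close> when the event is increasing.
\<close>
definition ones_upset :: "nat \<Rightarrow> (nat \<Rightarrow> bool) set \<Rightarrow> nat set set" where
  "ones_upset n A = {a. \<exists>x \<in> A. ones n x \<subseteq> a}"

lemma ones_upset_mono: "a \<in> ones_upset n A \<Longrightarrow> a \<subseteq> b \<Longrightarrow> b \<in> ones_upset n A"
  unfolding ones_upset_def by blast

lemma ones_in_ones_upset_iff:
  assumes "increasing_event n A" "x \<in> config_space n"
  shows "ones n x \<in> ones_upset n A \<longleftrightarrow> x \<in> A"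
proof
  assume "ones n x \<in> ones_upset n A"
  then obtain y where y: "y \<in> A" "ones n y \<subseteq> ones n x" by (auto simp: ones_upset_def)
  then have "config_le n y x" by (auto simp: config_le_def ones_def le_bool_def)
  moreover have "y \<in> config_space n" using y assms by (auto simp: increasing_event_def)
  ultimately have "(indicator A y :: real) \<le> indicator A x"
    using assms by (auto simp: increasing_event_def monotone_on_def)
  with y show "x \<in> A" by (simp add: indicator_def of_bool_def split: if_splits)
qed (auto simp: ones_upset_def)

lemma ones_surj:
  assumes "a \<subseteq> {1..n}"
  obtains x where "x \<in> config_space n" "ones n x = a"
proof
  show "restrict (\<lambda>i. i \<in> a) {1..n} \<in> config_space n" by (simp add: config_space_def)
  show "ones n (restrict (\<lambda>i. i \<in> a) {1..n}) = a" using assms by (auto simp: ones_def)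
qed

lemma prob_bernoulli_product_eq:
  assumes "\<And>x. x \<in> config_space n \<Longrightarrow> x \<in> E \<longleftrightarrow> ones n x \<in> F"
  shows "measure_pmf.prob (bernoulli_product n p) E = measure_pmf.prob (random_subset p {1..n}) F"
proof -
  have "set_pmf (bernoulli_product n p) \<subseteq> config_space n"
    by (auto simp: bernoulli_product_def config_space_def PiE_def extensional_def
        dest!: subsetD[OF set_Pi_pmf_subset, rotated])
  then have "measure_pmf.prob (bernoulli_product n p) E =
      measure_pmf.prob (bernoulli_product n p) (ones n -` F)"
    using assms by (intro measure_prob_cong_0) (auto simp: pmf_eq_0_set_pmf)
  then show ?thesis
    by (simp add: random_subset_def bernoulli_product_def ones_def[abs_def])
qed

text \<open>
  The coordinates of a witness where the configuration is 0 may be discarded: the configuration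
  that is 1 exactly on the remaining ones still belongs to the event.
\<close>
lemma witness_iff_ones:
  assumes "increasing_event n A" "u \<in> config_space n"
  shows "witness n A u I \<longleftrightarrow> I \<subseteq> {1..n} \<and> I \<inter> ones n u \<in> ones_upset n A"
proof
  assume w: "witness n A u I"
  obtain y where y: "y \<in> config_space n" "ones n y = I \<inter> ones n u"
    by (rule ones_surj[of "I \<inter> ones n u"]) (auto simp: ones_def)
  have "y i = u i" if "i \<in> I" for i
  proof -
    have "i \<in> {1..n}" using that w by (auto simp: witness_def)
    then show ?thesis using that y(2) unfolding ones_def by blast
  qed
  then have "y \<in> A" using w y by (auto simp: witness_def)
  then show "I \<subseteq> {1..n} \<and> I \<inter> ones n u \<in> ones_upset n A"
    using w y by (auto simp: witness_def ones_upset_def)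
next
  assume I: "I \<subseteq> {1..n} \<and> I \<inter> ones n u \<in> ones_upset n A"
  have "y \<in> A" if y: "y \<in> config_space n" "\<forall>i\<in>I. y i = u i" for y
  proof -
    have "I \<inter> ones n u \<subseteq> ones n y" using y by (auto simp: ones_def)
    then show ?thesis
      using I ones_upset_mono ones_in_ones_upset_iff[OF assms(1) y(1)] by blast
  qed
  then show "witness n A u I" using I by (simp add: witness_def)
qed

lemma disjoint_witnesses_iff_ones:
  assumes "increasing_event n A" "increasing_event n B" "u \<in> config_space n" "v \<in> config_space n"
  shows "disjoint_witnesses n A B u v \<longleftrightarrow>
    (\<exists>(a, b) \<in> ones_upset n A \<times> ones_upset n B. a \<inter> b = {} \<and> a \<subseteq> ones n u \<and> b \<subseteq> ones n v)"
proof
  assume "disjoint_witnesses n A B u v"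
  then obtain I J where "I \<inter> J = {}" "I \<inter> ones n u \<in> ones_upset n A" "J \<inter> ones n v \<in> ones_upset n B"
    using assms by (auto simp: disjoint_witnesses_def witness_iff_ones)
  then show "\<exists>(a, b) \<in> ones_upset n A \<times> ones_upset n B. a \<inter> b = {} \<and> a \<subseteq> ones n u \<and> b \<subseteq> ones n v"
    by (intro bexI[of _ "(I \<inter> ones n u, J \<inter> ones n v)"]) auto
next
  assume "\<exists>(a, b) \<in> ones_upset n A \<times> ones_upset n B. a \<inter> b = {} \<and> a \<subseteq> ones n u \<and> b \<subseteq> ones n v"
  then obtain a b where ab: "a \<in> ones_upset n A" "b \<in> ones_upset n B" "a \<inter> b = {}"
    "a \<subseteq> ones n u" "b \<subseteq> ones n v" by blast
  moreover have "a \<inter> ones n u = a" "b \<inter> ones n v = b" "a \<subseteq> {1..n}" "b \<subseteq> {1..n}"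
    using ab by (auto simp: ones_def)
  ultimately show "disjoint_witnesses n A B u v"
    unfolding disjoint_witnesses_def
    by (intro exI[of _ a] exI[of _ b]) (simp add: assms witness_iff_ones)
qed

lemma disjoint_occurrence_iff_ones:
  assumes "increasing_event n A" "increasing_event n B" "u \<in> config_space n"
  shows "u \<in> disjoint_occurrence n A B \<longleftrightarrow>
    ones n u \<in> disjoint_occ (ones_upset n A \<times> ones_upset n B)"
proof -
  have "u \<in> A \<inter> B" if "ones n u \<in> disjoint_occ (ones_upset n A \<times> ones_upset n B)"
  proof -
    have "ones n u \<in> ones_upset n A \<inter> ones_upset n B"
      using that ones_upset_mono by (fastforce simp: disjoint_occ_def)
    then show ?thesis using assms by (simp add: ones_in_ones_upset_iff)
  qed
  then show ?thesis
    using assms by (auto simp: disjoint_occurrence_def disjoint_witnesses_iff_ones disjoint_occ_def)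
qed

lemma disjoint_witnesses_iff_split_on:
  assumes "increasing_event n A" "increasing_event n B"
  shows "(\<forall>u\<in>A. \<forall>v\<in>B. disjoint_witnesses n A B u v) \<longleftrightarrow>
    split_on {1..n} (ones_upset n A \<times> ones_upset n B)"
proof
  assume dw: "\<forall>u\<in>A. \<forall>v\<in>B. disjoint_witnesses n A B u v"
  show "split_on {1..n} (ones_upset n A \<times> ones_upset n B)"
    unfolding split_on_def
  proof (intro allI impI)
    fix u v assume uv: "(u, v) \<in> ones_upset n A \<times> ones_upset n B" "u \<subseteq> {1..n}" "v \<subseteq> {1..n}"
    obtain x y where x: "x \<in> config_space n" "ones n x = u" and y: "y \<in> config_space n" "ones n y = v"
      using ones_surj[OF uv(2)] ones_surj[OF uv(3)] by metis
    have "x \<in> A" "y \<in> B" using uv(1) x y assms by (auto simp flip: ones_in_ones_upset_iff)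
    then show "\<exists>(a, b) \<in> ones_upset n A \<times> ones_upset n B. a \<inter> b = {} \<and> a \<subseteq> u \<and> b \<subseteq> v"
      using dw disjoint_witnesses_iff_ones[OF assms x(1) y(1)] x(2) y(2) by simp
  qed
next
  assume split: "split_on {1..n} (ones_upset n A \<times> ones_upset n B)"
  show "\<forall>u\<in>A. \<forall>v\<in>B. disjoint_witnesses n A B u v"
  proof (intro ballI)
    fix u v assume uv: "u \<in> A" "v \<in> B"
    then have c: "u \<in> config_space n" "v \<in> config_space n"
      using assms by (auto simp: increasing_event_def)
    have "(ones n u, ones n v) \<in> ones_upset n A \<times> ones_upset n B"
      using uv by (auto simp: ones_upset_def)
    moreover have "ones n u \<subseteq> {1..n}" "ones n v \<subseteq> {1..n}" by (auto simp: ones_def)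
    ultimately show "disjoint_witnesses n A B u v"
      using split unfolding disjoint_witnesses_iff_ones[OF assms c] split_on_def by blast
  qed
qed

lemma prob_pair_pmf_Times:
  "measure_pmf.prob (pair_pmf M N) (A \<times> B) = measure_pmf.prob M A * measure_pmf.prob N B"
proof -
  have "measure_pmf.prob (pair_pmf M N) (A \<times> B) =
      measure_pmf.prob (pair_pmf M N) ((A \<inter> set_pmf M) \<times> (B \<inter> set_pmf N))"
    by (subst measure_Int_set_pmf[symmetric]) (simp add: Times_Int_Times)
  also have "\<dots> = measure_pmf.prob M (A \<inter> set_pmf M) * measure_pmf.prob N (B \<inter> set_pmf N)"
    by (intro measure_pmf_prob_product) auto
  finally show ?thesis by (simp add: measure_Int_set_pmf)
qed

theorem theorem1p3:
  fixes n :: nat and p :: real and A B :: "(nat \<Rightarrow> bool) set"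
  assumes "n \<ge> 1"
    and "0 < p" and "p < 1"
    and "increasing_event n A"
    and "increasing_event n B"
  shows "measure_pmf.prob (bernoulli_product n p) (disjoint_occurrence n A B)
           = measure_pmf.prob (bernoulli_product n p) A * measure_pmf.prob (bernoulli_product n p) B
         \<longleftrightarrow> (\<forall>u\<in>A. \<forall>v\<in>B. disjoint_witnesses n A B u v)"
proof -
  let ?W = "ones_upset n A \<times> ones_upset n B"
  note inc = assms(4,5)
  have up: "up_pairs ?W" by (auto simp: up_pairs_def intro: ones_upset_mono)
  have "measure_pmf.prob (bernoulli_product n p) A * measure_pmf.prob (bernoulli_product n p) B
      - measure_pmf.prob (bernoulli_product n p) (disjoint_occurrence n A B)
      = bk_gap p {1..n} ?W"
    using prob_bernoulli_product_eq[of n A "ones_upset n A"]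
      prob_bernoulli_product_eq[of n B "ones_upset n B"]
      prob_bernoulli_product_eq[of n "disjoint_occurrence n A B" "disjoint_occ ?W"]
    by (simp add: bk_gap_def prob_pair_pmf_Times ones_in_ones_upset_iff inc
        disjoint_occurrence_iff_ones)
  moreover have "bk_gap p {1..n} ?W = 0 \<longleftrightarrow> split_on {1..n} ?W"
    using split_if_bk_gap_zero[OF _ assms(2,3) up, of "{1..n}"]
      bk_gap_zero_if_split[OF _ assms(2,3) up rectangle_on_Times, of "{1..n}"] by auto
  ultimately show ?thesis
    unfolding disjoint_witnesses_iff_split_on[OF inc] by linarith
qed

end
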